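(* A Tychonoff space is hereditary $2$-Ascoli if and only if it is Fréchet–Urysohn. Consequently, a Tychonoff space is hereditary Ascoli if and only if it is Fréchet–Urysohn.
   Context: For Tychonoff spaces $X$ and $Y$, $C_k(X,Y)$ is the space of continuous functions $X\to Y$ with the compact-open topology. A set $K\subseteq C_k(X,Y)$ is evenly continuous if the evaluation map $K\times X\to Y$, $(f,x)\mapsto f(x)$, is continuous. $X$ is Ascoli if every compact subset of $C_k(X,\mathbb{R})$ is evenly continuous; $X$ is $2$-Ascoli if every compact subset of $C_k(X,\mathbf{2})$ is evenly continuous, where $\mathbf{2}=\{0,1\}$ is discrete. A space is hereditary Ascoli (hereditary $2$-Ascoli) if every subspace of it is Ascoli ($2$-Ascoli). A space $X$ is Fréchet–Urysohn if for every $A\subseteq X$ and every $x\in\overline{A}$ there is a sequence in $A$ converging to $x$. *)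

theory Defs
  imports "HOL-Analysis.Analysis"
begin

definition Tychonoff_space :: "'a topology \<Rightarrow> bool" where
  "Tychonoff_space X \<longleftrightarrow> completely_regular_space X \<and> Hausdorff_space X"

(* Continuous maps are represented by their extensional representatives (value undefined
   outside topspace X), so that two elements are equal iff they agree on topspace X. *)
definition cont_maps :: "'a topology \<Rightarrow> 'b topology \<Rightarrow> ('a \<Rightarrow> 'b) set" where
  "cont_maps X Y = {f \<in> extensional (topspace X). continuous_map X Y f}"

(* The sets below form a subbase; the choice C = {} shows that the underlying set is
   all of cont_maps X Y. *)
definition compact_open_topology :: "'a topology \<Rightarrow> 'b topology \<Rightarrow> ('a \<Rightarrow> 'b) topology" where
  "compact_open_topology X Y =
     topology_generated_by
       {{f \<in> cont_maps X Y. f ` C \<subseteq> U} | C U. compactin X C \<and> openin Y U}"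

lemma topspace_compact_open_topology:
  "topspace (compact_open_topology X Y) = cont_maps X Y"
proof -
  have "cont_maps X Y \<in> {{f \<in> cont_maps X Y. f ` C \<subseteq> U} | C U. compactin X C \<and> openin Y U}"
    by (rule CollectI, rule exI[of _ "{}"], rule exI[of _ "{}"]) auto
  then show ?thesis
    unfolding compact_open_topology_def topology_generated_by_topspace by blast
qed

definition evenly_continuous :: "'a topology \<Rightarrow> 'b topology \<Rightarrow> ('a \<Rightarrow> 'b) set \<Rightarrow> bool" where
  "evenly_continuous X Y K \<longleftrightarrow>
     continuous_map (prod_topology (subtopology (compact_open_topology X Y) K) X) Y
       (\<lambda>(f, x). f x)"

definition Ascoli_space :: "'a topology \<Rightarrow> bool" where
  "Ascoli_space X \<longleftrightarrow>
     (\<forall>K. compactin (compact_open_topology X (euclidean :: real topology)) K \<longrightarrow>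
          evenly_continuous X (euclidean :: real topology) K)"

definition two_Ascoli_space :: "'a topology \<Rightarrow> bool" where
  "two_Ascoli_space X \<longleftrightarrow>
     (\<forall>K. compactin (compact_open_topology X (discrete_topology {0, 1 :: nat})) K \<longrightarrow>
          evenly_continuous X (discrete_topology {0, 1 :: nat}) K)"

definition hereditary_Ascoli :: "'a topology \<Rightarrow> bool" where
  "hereditary_Ascoli X \<longleftrightarrow> (\<forall>S \<subseteq> topspace X. Ascoli_space (subtopology X S))"

definition hereditary_two_Ascoli :: "'a topology \<Rightarrow> bool" where
  "hereditary_two_Ascoli X \<longleftrightarrow> (\<forall>S \<subseteq> topspace X. two_Ascoli_space (subtopology X S))"

definition Frechet_Urysohn :: "'a topology \<Rightarrow> bool" where
  "Frechet_Urysohn X \<longleftrightarrow>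
     (\<forall>A \<subseteq> topspace X. \<forall>x \<in> X closure_of A.
        \<exists>a :: nat \<Rightarrow> 'a. range a \<subseteq> A \<and> limitin X a x sequentially)"

end

theory Submission
  imports Defs
begin

text \<open>
  Suppose \<open>X\<close> is Hausdorff, \<open>x\<close> is in the closure of \<open>A\<close> but not in \<open>A\<close>, and no sequence in \<open>A\<close>
  converges to \<open>x\<close>. Take a maximal disjoint family \<open>\<U>\<close> of open subsets of \<open>A\<close> whose
  closures miss \<open>x\<close>. Its union is dense in \<open>A\<close>, and each member is clopen in \<open>S = \<Union>\<U> \<union> {x}\<close>, although
  it need not be so in \<open>A \<union> {x}\<close>. A compact \<open>C \<subseteq> S\<close> meets only finitely many members: points of
  \<open>C\<close> chosen from infinitely many distinct members converge to \<open>x\<close>, since \<open>C - W\<close> is compact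
  and covered by \<open>\<U>\<close> for each open \<open>W \<ni> x\<close>. So the characteristic functions of the members, together with
  \<open>0\<close>, form a compact set, at which evaluation is discontinuous at \<open>(0, x)\<close>.

  Conversely, let \<open>X\<close> be Frechet-Urysohn and \<open>K\<close> compact. If evaluation failed to be continuous at
  \<open>(f, x)\<close>, there would be \<open>y\<^sub>n \<rightarrow> x\<close> and \<open>f\<^sub>n \<in> K\<close> with \<open>f\<^sub>n x\<close> near \<open>f x\<close> and \<open>f\<^sub>n y\<^sub>n\<close> not.
  Each \<open>g \<in> K\<close> then has a neighbourhood, given by a tail \<open>{x} \<union> {y\<^sub>n | n \<ge> N}\<close> or by \<open>{x}\<close>,
  that contains only finitely many \<open>f\<^sub>n\<close>, contradicting compactness.
\<close>

section \<open>Basic facts on the compact-open topology\<close>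

lemma openin_compact_open:
  assumes "compactin X C" "openin Y U"
  shows "openin (compact_open_topology X Y) {f \<in> cont_maps X Y. f ` C \<subseteq> U}"
  unfolding compact_open_topology_def
  by (rule topology_generated_by_Basis) (use assms in blast)

lemma compactin_subset_cont_maps:
  assumes "compactin (compact_open_topology X Y) K"
  shows "K \<subseteq> cont_maps X Y"
  using compactin_subset_topspace[OF assms] by (simp add: topspace_compact_open_topology)

section \<open>Even continuity over Frechet-Urysohn spaces\<close>

lemma Frechet_Urysohn_subtopology:
  assumes "Frechet_Urysohn X"
  shows "Frechet_Urysohn (subtopology X S)"
  unfolding Frechet_Urysohn_def
proof (intro allI impI ballI)
  fix A x
  assume A: "A \<subseteq> topspace (subtopology X S)" and x: "x \<in> subtopology X S closure_of A"
  have AS: "A \<subseteq> S" "A \<subseteq> topspace X" and "x \<in> S" and xA: "x \<in> X closure_of A"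
    using A x by (auto simp: closure_of_subtopology Int_absorb1 topspace_subtopology)
  obtain a :: "nat \<Rightarrow> 'a" where "range a \<subseteq> A" "limitin X a x sequentially"
    using assms AS(2) xA unfolding Frechet_Urysohn_def by blast
  then show "\<exists>a::nat \<Rightarrow> 'a. range a \<subseteq> A \<and> limitin (subtopology X S) a x sequentially"
    using AS \<open>x \<in> S\<close>
    by (intro exI[of _ a]) (auto simp: limitin_subtopology intro!: always_eventually)
qed

text \<open>The uniform core of even continuity: one \<open>N\<close> serves all members of
  \<open>K\<close> whose value at \<open>x\<close> lies in \<open>P\<close>. Regularity of
  \<open>Y\<close> will supply \<open>Q\<close>, which lets functions with value at \<open>x\<close>
  outside \<open>U\<close> be separated from the \<open>f n\<close> at \<open>x\<close>
  alone.\<close>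

lemma Frechet_Urysohn_compact_uniform_neighbourhood:
  assumes FU: "Frechet_Urysohn X"
    and K: "compactin (compact_open_topology X Y) K"
    and x: "x \<in> topspace X"
    and U: "openin Y U" and Q: "P \<inter> Q = {}" "topspace Y - U \<subseteq> Q" "openin Y Q"
  obtains N where "openin X N" "x \<in> N" "\<And>f y. f \<in> K \<Longrightarrow> f x \<in> P \<Longrightarrow> y \<in> N \<Longrightarrow> f y \<in> U"
proof -
  let ?C = "compact_open_topology X Y"
  define B where "B = {y \<in> topspace X. \<exists>f\<in>K. f x \<in> P \<and> f y \<notin> U}"
  have "x \<notin> X closure_of B"
  proof
    assume "x \<in> X closure_of B"
    moreover have "B \<subseteq> topspace X"
      by (auto simp: B_def)
    ultimately obtain y :: "nat \<Rightarrow> 'a" where y: "range y \<subseteq> B" and lim: "limitin X y x sequentially"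
      using FU unfolding Frechet_Urysohn_def by blast
    have "\<forall>n. \<exists>f\<in>K. f x \<in> P \<and> f (y n) \<notin> U"
      using y by (auto simp: B_def)
    then obtain f where fK: "\<And>n. f n \<in> K" and f: "\<And>n. f n x \<in> P" "\<And>n. f n (y n) \<notin> U"
      by metis
    have ytop: "y n \<in> topspace X" for n
      using y by (auto simp: B_def)
    have "\<exists>W N. openin ?C W \<and> g \<in> W \<and> (\<forall>n\<ge>N. f n \<notin> W)" if g: "g \<in> K" for g
    proof -
      have gc: "g \<in> cont_maps X Y"
        using compactin_subset_cont_maps[OF K] g by blast
      then have cg: "continuous_map X Y g"
        by (simp add: cont_maps_def)
      have gx: "g x \<in> topspace Y"
        using continuous_map_image_subset_topspace[OF cg] x by auto
      show ?thesis
      proof (cases "g x \<in> U")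
        case True
        have "limitin Y (g \<circ> y) (g x) sequentially"
          using continuous_map_limit[OF cg] lim by blast
        then obtain N where N: "\<And>n. n \<ge> N \<Longrightarrow> g (y n) \<in> U"
          using U True by (auto simp: limitin_sequentially)
        \<comment> \<open>Shifting by \<open>N\<close> keeps only terms that \<open>g\<close> maps
          into \<open>U\<close>. For \<open>n \<ge> N\<close> the point \<open>y n\<close> of
          \<open>C\<close> shows that \<open>f n\<close> does not map \<open>C\<close> into
          \<open>U\<close>.\<close>
        define C where "C = insert x (range (\<lambda>n. y (n + N)))"
        have "compactin X C"
          unfolding C_def by (rule compactin_sequence_with_limit) (use lim ytop in auto)
        then have "openin ?C {h \<in> cont_maps X Y. h ` C \<subseteq> U}"
          using U by (rule openin_compact_open)
        moreover have "g \<in> {h \<in> cont_maps X Y. h ` C \<subseteq> U}"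
          using gc N True by (auto simp: C_def)
        moreover have "f n \<notin> {h \<in> cont_maps X Y. h ` C \<subseteq> U}" if n: "n \<ge> N" for n
        proof -
          have "y n \<in> C"
            using le_add_diff_inverse2[OF n] unfolding C_def by (metis insertI2 rangeI)
          then show ?thesis
            using f(2) by blast
        qed
        ultimately show ?thesis
          by blast
      next
        case False
        \<comment> \<open>Here \<open>g x\<close> lies in \<open>Q\<close> while every
          \<open>f n x\<close> lies in \<open>P\<close>, so no \<open>f n\<close> at all enters this
          neighbourhood of \<open>g\<close>.\<close>
        have "openin ?C {h \<in> cont_maps X Y. h ` {x} \<subseteq> Q}"
          using x Q(3) by (intro openin_compact_open) auto
        moreover have "g \<in> {h \<in> cont_maps X Y. h ` {x} \<subseteq> Q}"
          using gc gx False Q(2) by auto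
        moreover have "f n \<notin> {h \<in> cont_maps X Y. h ` {x} \<subseteq> Q}" for n
          using f(1)[of n] Q(1) by auto
        ultimately show ?thesis
          by blast
      qed
    qed
    then obtain W N where W: "\<And>g. g \<in> K \<Longrightarrow> openin ?C (W g)"
      "\<And>g. g \<in> K \<Longrightarrow> g \<in> W g" and N: "\<And>g n. g \<in> K \<Longrightarrow> n \<ge> N g \<Longrightarrow> f n \<notin> W g"
      by metis
    have "\<exists>\<F>. finite \<F> \<and> \<F> \<subseteq> W ` K \<and> K \<subseteq> \<Union>\<F>"
      by (intro compactinD[OF K]) (use W in auto)
    then obtain \<F> where "finite \<F>" "\<F> \<subseteq> W ` K" "K \<subseteq> \<Union>\<F>"
      by blast
    then obtain G where G: "finite G" "G \<subseteq> K" "K \<subseteq> (\<Union>g\<in>G. W g)"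
      using finite_subset_image by metis
    \<comment> \<open>This index reaches every bound \<open>N g\<close> of the finite subcover, yet
      \<open>f n\<close> must lie in one of its sets. The inserted 0 spares a proof that
      \<open>G\<close> is nonempty.\<close>
    define n where "n = Max (insert 0 (N ` G))"
    obtain g where "g \<in> G" "f n \<in> W g"
      using G fK by blast
    moreover have "N g \<le> n"
      using G(1) \<open>g \<in> G\<close> by (simp add: n_def)
    ultimately show False
      using N G by blast
  qed
  then obtain N where N: "openin X N" "x \<in> N" "N \<inter> B = {}"
    using x by (auto simp: in_closure_of)
  have "f y \<in> U" if "f \<in> K" "f x \<in> P" "y \<in> N" for f y
    using that N(3) openin_subset[OF N(1)] by (force simp: B_def)
  then show thesis
    using that N by blast
qed

text \<open>A regular \<open>Y\<close> covers both the discrete two-point space and the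
  reals.\<close>

lemma Frechet_Urysohn_evenly_continuous:
  assumes FU: "Frechet_Urysohn X" and Y: "regular_space Y"
    and K: "compactin (compact_open_topology X Y) K"
  shows "evenly_continuous X Y K"
proof -
  let ?C = "compact_open_topology X Y"
  let ?P = "prod_topology (subtopology ?C K) X"
  note KC = compactin_subset_cont_maps[OF K]
  have val: "f x \<in> topspace Y" if "f \<in> K" "x \<in> topspace X" for f x
    using KC that by (auto simp: cont_maps_def continuous_map_def Pi_iff)
  show ?thesis
    unfolding evenly_continuous_def continuous_map_def
  proof (intro conjI allI impI)
    show "(\<lambda>(f, x). f x) \<in> topspace ?P \<rightarrow> topspace Y"
      using val by auto
  next
    fix U assume U: "openin Y U"
    show "openin ?P {p \<in> topspace ?P. (case p of (f, x) \<Rightarrow> f x) \<in> U}" (is "openin ?P ?R")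
    proof (subst openin_subopen, intro ballI)
      fix p assume p: "p \<in> ?R"
      then obtain f x where p_eq: "p = (f, x)" and f: "f \<in> K" and x: "x \<in> topspace X" and "f x \<in> U"
        by auto
      moreover have "closedin Y (topspace Y - U)"
        using U by blast
      ultimately obtain P Q where PQ: "openin Y P" "openin Y Q" "f x \<in> P" "topspace Y - U \<subseteq> Q" "P \<inter> Q = {}"
        using Y val unfolding regular_space_def disjnt_def by (metis DiffD2 DiffI)
      then obtain N where N: "openin X N" "x \<in> N" "\<And>h y. h \<in> K \<Longrightarrow> h x \<in> P \<Longrightarrow> y \<in> N \<Longrightarrow> h y \<in> U"
        using Frechet_Urysohn_compact_uniform_neighbourhood[OF FU K x U] by metis
      \<comment> \<open>Membership in \<open>W\<close> puts \<open>h x\<close> into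
        \<open>P\<close>, the condition under which \<open>N\<close> controls
        \<open>h\<close>.\<close>
      define W where "W = {h \<in> cont_maps X Y. h ` {x} \<subseteq> P}"
      have W: "openin ?C W"
        unfolding W_def using x PQ(1) by (intro openin_compact_open) auto
      have "openin ?P ((W \<inter> K) \<times> N)"
        using W N(1) by (auto simp: openin_prod_Times_iff openin_subtopology)
      moreover have "p \<in> (W \<inter> K) \<times> N"
        using f KC N(2) PQ(3) by (auto simp: p_eq W_def)
      moreover have "(W \<inter> K) \<times> N \<subseteq> ?R"
        using N KC openin_subset[OF N(1)] by (auto simp: W_def topspace_compact_open_topology)
      ultimately show "\<exists>S. openin ?P S \<and> p \<in> S \<and> S \<subseteq> ?R"
        by blast
    qed
  qed
qed

section \<open>Disjoint families of open sets\<close>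

lemma finite_compactin_disjoint_open:
  assumes "compactin X C" "\<And>U. U \<in> \<U> \<Longrightarrow> openin X U" "disjoint \<U>" "C \<subseteq> \<Union>\<U>"
  shows "finite {U \<in> \<U>. U \<inter> C \<noteq> {}}"
proof -
  obtain \<F> where \<F>: "finite \<F>" "\<F> \<subseteq> \<U>" "C \<subseteq> \<Union>\<F>"
    using compactinD[OF assms(1), of \<U>] assms(2,4) by blast
  \<comment> \<open>By disjointness a point of \<open>U\<close> in \<open>C\<close> can be covered
    only by \<open>U\<close> itself, so the subcover omits no member meeting
    \<open>C\<close>.\<close>
  have "{U \<in> \<U>. U \<inter> C \<noteq> {}} \<subseteq> \<F>"
  proof
    fix U assume "U \<in> {U \<in> \<U>. U \<inter> C \<noteq> {}}"
    then obtain y where U: "U \<in> \<U>" "y \<in> U" "y \<in> C"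
      by blast
    then obtain U' where "U' \<in> \<F>" "y \<in> U'"
      using \<F> by blast
    then show "U \<in> \<F>"
      using U \<F>(2) \<open>disjoint \<U>\<close> by (metis disjointD disjoint_iff subsetD)
  qed
  then show ?thesis
    using \<F>(1) finite_subset by blast
qed

text \<open>Zorn's lemma gives a maximal disjoint family of open sets with \<open>P\<close>. If its
  union were not dense, a nonempty open set missing it would contain a nonempty set that could be
  added.\<close>

lemma disjoint_open_family_dense:
  assumes "\<And>V. openin X V \<Longrightarrow> V \<noteq> {} \<Longrightarrow> \<exists>U\<subseteq>V. U \<noteq> {} \<and> openin X U \<and> P U"
  obtains \<U> where "disjoint \<U>" "\<And>U. U \<in> \<U> \<Longrightarrow> openin X U" "\<And>U. U \<in> \<U> \<Longrightarrow> P U"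
    "X closure_of \<Union>\<U> = topspace X"
proof -
  let ?F = "{\<U>. disjoint \<U> \<and> (\<forall>U\<in>\<U>. openin X U \<and> P U)}"
  have "\<Union>\<C> \<in> ?F" if "subset.chain ?F \<C>" for \<C>
  proof -
    have "disjoint (\<Union>\<C>)"
    proof (rule disjointI)
      fix U V assume "U \<in> \<Union>\<C>" "V \<in> \<Union>\<C>" "U \<noteq> V"
      then obtain \<U> \<V> where UV: "\<U> \<in> \<C>" "\<V> \<in> \<C>" "U \<in> \<U>" "V \<in> \<V>"
        by blast
      then have "\<U> \<subseteq> \<V> \<or> \<V> \<subseteq> \<U>" and dis: "disjoint \<U>" "disjoint \<V>"
        using that unfolding subset_chain_def by blast+
      then consider "V \<in> \<U>" | "U \<in> \<V>"
        using UV by blast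
      then show "U \<inter> V = {}"
        using UV dis[THEN disjointD] \<open>U \<noteq> V\<close> by cases auto
    qed
    then show ?thesis
      using that unfolding subset_chain_def by blast
  qed
  then have "\<exists>\<U>\<in>?F. \<forall>\<V>\<in>?F. \<U> \<subseteq> \<V> \<longrightarrow> \<V> = \<U>"
    by (rule subset_Zorn')
  then obtain \<U> where \<U>: "\<U> \<in> ?F" and max: "\<And>\<V>. \<V> \<in> ?F \<Longrightarrow> \<U> \<subseteq> \<V> \<Longrightarrow> \<V> = \<U>"
    by meson
  have "x \<in> X closure_of \<Union>\<U>" if "x \<in> topspace X" for x
  proof (rule ccontr)
    assume "x \<notin> X closure_of \<Union>\<U>"
    then obtain V where V: "openin X V" "x \<in> V" "V \<inter> \<Union>\<U> = {}"
      using \<open>x \<in> topspace X\<close> unfolding in_closure_of by blast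
    then obtain U where U: "U \<subseteq> V" "U \<noteq> {}" "openin X U" "P U"
      using assms[of V] by blast
    have "disjoint (insert U \<U>)"
      using \<U> U(1) V(3) by (auto simp: pairwise_insert disjnt_def)
    then have "insert U \<U> = \<U>"
      using max[of "insert U \<U>"] \<U> U by blast
    then show False
      using U(1,2) V(3) by blast
  qed
  then have "X closure_of \<Union>\<U> = topspace X"
    using closure_of_subset_topspace[of X "\<Union>\<U>"] by (intro equalityI subsetI) auto
  then show thesis
    using \<U> by (intro that) auto
qed

section \<open>Families of functions clustering at a single function\<close>

lemma finite_outside_compact_open_neighbourhood:
  assumes "openin (compact_open_topology X Y) W" "z \<in> W"
    and F: "F \<subseteq> cont_maps X Y"
    and fin: "\<And>C. compactin X C \<Longrightarrow> finite {f \<in> F. \<exists>x\<in>C. f x \<noteq> z x}"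
  shows "finite {f \<in> F. f \<notin> W}"
proof -
  have "generate_topology_on {{f \<in> cont_maps X Y. f ` C \<subseteq> U} | C U. compactin X C \<and> openin Y U} W"
    using assms(1) unfolding compact_open_topology_def openin_topology_generated_by_iff .
  then show ?thesis
    using \<open>z \<in> W\<close>
  \<comment> \<open>Exceptions to an intersection lie in a union of two finite sets; for a union,
    one member containing \<open>z\<close> suffices; a function outside a subbasic set around
    \<open>z\<close> must differ from \<open>z\<close> somewhere on \<open>C\<close>.\<close>
  proof induction
    case Empty
    then show ?case by simp
  next
    case (Int a b)
    then have "finite ({f \<in> F. f \<notin> a} \<union> {f \<in> F. f \<notin> b})"
      by simp
    then show ?case
      by (rule rev_finite_subset) blast
  next
    case (UN K)
    then obtain k where "k \<in> K" "finite {f \<in> F. f \<notin> k}"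
      by blast
    then show ?case
      by (elim rev_finite_subset) blast
  next
    case (Basis s)
    then obtain C U where s: "s = {f \<in> cont_maps X Y. f ` C \<subseteq> U}" "compactin X C"
      by blast
    have "{f \<in> F. f \<notin> s} \<subseteq> {f \<in> F. \<exists>x\<in>C. f x \<noteq> z x}"
      using F Basis.prems by (fastforce simp: s(1))
    then show ?case
      using fin[OF s(2)] finite_subset by blast
  qed
qed

text \<open>As for a convergent sequence with its limit, a member of the cover around
  \<open>z\<close> leaves only finitely many functions to cover.\<close>

lemma compactin_compact_open_insert_limit:
  assumes z: "z \<in> cont_maps X Y" and F: "F \<subseteq> cont_maps X Y"
    and fin: "\<And>C. compactin X C \<Longrightarrow> finite {f \<in> F. \<exists>x\<in>C. f x \<noteq> z x}"
  shows "compactin (compact_open_topology X Y) (insert z F)"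
  unfolding compactin_def
proof (intro conjI allI impI)
  show "insert z F \<subseteq> topspace (compact_open_topology X Y)"
    using z F by (simp add: topspace_compact_open_topology)
next
  fix \<W> assume \<W>: "(\<forall>W\<in>\<W>. openin (compact_open_topology X Y) W) \<and> insert z F \<subseteq> \<Union>\<W>"
  then obtain W where W: "W \<in> \<W>" "z \<in> W" "openin (compact_open_topology X Y) W"
    by blast
  have "\<forall>f\<in>F. \<exists>W\<in>\<W>. f \<in> W"
    using \<W> by blast
  then obtain w where w: "\<And>f. f \<in> F \<Longrightarrow> w f \<in> \<W> \<and> f \<in> w f"
    by metis
  let ?\<F> = "insert W (w ` {f \<in> F. f \<notin> W})"
  have "finite ?\<F>"
    using finite_outside_compact_open_neighbourhood[OF W(3,2) F fin] by simp
  moreover have "?\<F> \<subseteq> \<W>" "insert z F \<subseteq> \<Union>?\<F>"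
    using w W by auto
  ultimately show "\<exists>\<F>. finite \<F> \<and> \<F> \<subseteq> \<W> \<and> insert z F \<subseteq> \<Union>\<F>"
    by blast
qed

section \<open>From even continuity on subspaces to the Frechet-Urysohn property\<close>

lemma hereditary_evenly_continuous_imp_Frechet_Urysohn:
  assumes X: "Hausdorff_space X"
    and ec: "\<And>S K. S \<subseteq> topspace X \<Longrightarrow> compactin (compact_open_topology (subtopology X S) Y) K
               \<Longrightarrow> evenly_continuous (subtopology X S) Y K"
    and V: "openin Y V" "a \<in> V" and b: "b \<in> topspace Y" "b \<notin> V"
  shows "Frechet_Urysohn X"
  unfolding Frechet_Urysohn_def
proof (intro allI impI ballI)
  fix A x assume A: "A \<subseteq> topspace X" and xA: "x \<in> X closure_of A"
  have x: "x \<in> topspace X"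
    using xA by (simp add: in_closure_of)
  have aY: "a \<in> topspace Y"
    using V openin_subset by blast
  show "\<exists>a::nat \<Rightarrow> 'a. range a \<subseteq> A \<and> limitin X a x sequentially"
  proof (cases "x \<in> A")
    case True
    then show ?thesis
      using x by (intro exI[of _ "\<lambda>_. x"]) auto
  next
    case False
    show ?thesis
    proof (rule ccontr)
      assume no: "\<not> (\<exists>a::nat \<Rightarrow> 'a. range a \<subseteq> A \<and> limitin X a x sequentially)"
      have "\<exists>U\<subseteq>G. U \<noteq> {} \<and> openin (subtopology X A) U \<and> x \<notin> X closure_of U"
        if G: "openin (subtopology X A) G" "G \<noteq> {}" for G
      proof -
        obtain y where y: "y \<in> G"
          using G(2) by blast
        then have "y \<in> A" "y \<noteq> x"
          using openin_subset[OF G(1)] False by auto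
        then obtain M N where MN: "openin X M" "openin X N" "y \<in> M" "x \<in> N" "disjnt M N"
          using X A x unfolding Hausdorff_space_def by (metis subsetD)
        then have "x \<notin> X closure_of (G \<inter> M)"
          unfolding in_closure_of disjnt_def by blast
        moreover have "openin (subtopology X A) (G \<inter> M)"
          using G(1) MN(1) unfolding openin_subtopology by (metis inf.assoc inf.commute openin_Int)
        ultimately show ?thesis
          using y MN(3) by (intro exI[of _ "G \<inter> M"]) auto
      qed
      then obtain \<U> where \<U>: "disjoint \<U>" "\<And>U. U \<in> \<U> \<Longrightarrow> openin (subtopology X A) U"
          "\<And>U. U \<in> \<U> \<Longrightarrow> x \<notin> X closure_of U"
          and dense: "subtopology X A closure_of \<Union>\<U> = topspace (subtopology X A)"
        using disjoint_open_family_dense[of "subtopology X A" "\<lambda>U. x \<notin> X closure_of U"] by blast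
      define S where "S = insert x (\<Union>\<U>)"
      define T where "T = subtopology X S"
      have UA: "\<Union>\<U> \<subseteq> A"
        using \<U>(2) openin_subset by fastforce
      have S: "S \<subseteq> topspace X"
        using UA A x by (auto simp: S_def)
      then have topT: "topspace T = S"
        by (simp add: T_def Int_absorb1)
      have xU: "x \<in> X closure_of \<Union>\<U>"
      proof -
        have "A \<subseteq> X closure_of \<Union>\<U>"
          using dense A UA by (auto simp: closure_of_subtopology Int_absorb1)
        then show ?thesis
          using xA by (metis closure_of_closure_of closure_of_mono subsetD)
      qed
      have openU: "openin T U" if U: "U \<in> \<U>" for U
      proof -
        obtain G where G: "openin X G" "U = G \<inter> A"
          using \<U>(2)[OF U] by (auto simp: openin_subtopology)
        \<comment> \<open>\<open>G\<close> may contain \<open>x\<close>, which lies in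
          \<open>S\<close> but not in \<open>A\<close>; once \<open>x\<close> is removed, the trace
          on \<open>S\<close> is exactly \<open>U\<close>.\<close>
        have "openin X (G - {x})"
          using G(1) X x by (simp add: closedin_Hausdorff_singleton openin_diff)
        moreover have "U = (G - {x}) \<inter> S"
          using G(2) U UA False by (auto simp: S_def)
        ultimately show ?thesis
          by (auto simp: T_def openin_subtopology)
      qed
      have open_compl: "openin T (S - U)" if U: "U \<in> \<U>" for U
      proof -
        \<comment> \<open>The other members cover all of \<open>S - U\<close> except
          \<open>x\<close>, and \<open>?N\<close> is a neighbourhood of \<open>x\<close> that misses
          \<open>U\<close>.\<close>
        let ?M = "\<Union>(\<U> - {U})" and ?N = "(topspace X - X closure_of U) \<inter> S"
        have "openin T (?M \<union> ?N)"
        proof (rule openin_Un)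
          show "openin T ?M"
            by (rule openin_Union) (use openU in auto)
          show "openin T ?N"
            unfolding T_def by (intro openin_subtopology_Int openin_diff) auto
        qed
        moreover have "?M \<union> ?N = S - U"
        proof -
          have "U \<subseteq> X closure_of U"
            using U UA A by (intro closure_of_subset) blast
          moreover have "?M \<inter> U = {}"
            using U \<U>(1) by (blast dest: disjointD)
          moreover have "x \<in> ?N"
            using \<U>(3)[OF U] x by (simp add: S_def)
          moreover have "S = ?M \<union> U \<union> {x}"
            using U by (auto simp: S_def)
          ultimately show ?thesis
            by auto
        qed
        ultimately show ?thesis
          by simp
      qed
      have compact_finite: "finite {U \<in> \<U>. U \<inter> C \<noteq> {}}" if C: "compactin T C" for C
      proof (rule ccontr)
        assume "infinite {U \<in> \<U>. U \<inter> C \<noteq> {}}"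
        then obtain u :: "nat \<Rightarrow> 'a set" where u: "inj u" "range u \<subseteq> {U \<in> \<U>. U \<inter> C \<noteq> {}}"
          using infinite_countable_subset by blast
        then have "\<forall>n. \<exists>y. y \<in> u n \<inter> C"
          by blast
        then obtain c where c: "\<And>n. c n \<in> u n" "\<And>n. c n \<in> C"
          by (metis IntE)
        have "limitin X c x sequentially"
          unfolding limitin_def
        proof (intro conjI allI impI x)
          fix W assume W: "openin X W \<and> x \<in> W"
          have "openin T (W \<inter> S)"
            using W unfolding T_def by (intro openin_subtopology_Int) simp
          then have "closedin T (topspace T - W \<inter> S)"
            by blast
          then have "closedin T (topspace T - W)"
            by (simp add: topT Diff_Int)
          then have "compactin T ((topspace T - W) \<inter> C)"
            using C closed_Int_compactin by blast
          moreover have "(topspace T - W) \<inter> C \<subseteq> \<Union>\<U>"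
            using W by (auto simp: topT S_def)
          ultimately have "finite {U \<in> \<U>. U \<inter> ((topspace T - W) \<inter> C) \<noteq> {}}"
            using openU \<U>(1) by (intro finite_compactin_disjoint_open)
          \<comment> \<open>Injectivity of \<open>u\<close> turns finitely many members into
            finitely many indices.\<close>
          then have "finite (u -` {U \<in> \<U>. U \<inter> ((topspace T - W) \<inter> C) \<noteq> {}})"
            using u(1) by (rule finite_vimageI)
          moreover have "{n. c n \<notin> W} \<subseteq> u -` {U \<in> \<U>. U \<inter> ((topspace T - W) \<inter> C) \<noteq> {}}"
            using c u(2) compactin_subset_topspace[OF C] by blast
          ultimately have "finite {n. c n \<notin> W}"
            using finite_subset by blast
          then show "\<forall>\<^sub>F n in sequentially. c n \<in> W"
            by (simp add: eventually_cofinite flip: cofinite_eq_sequentially)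
        qed
        moreover have "range c \<subseteq> A"
          using c(1) u(2) UA by blast
        ultimately show False
          using no by blast
      qed
      \<comment> \<open>The values \<open>a\<close> in \<open>V\<close> and \<open>b\<close> outside
        \<open>V\<close> stand in for 0 and 1; \<open>restrict\<close> yields the extensional
        representatives required by \<open>cont_maps\<close>.\<close>
      define z where "z = restrict (\<lambda>_. a) S"
      define ind where "ind = (\<lambda>U. restrict (\<lambda>y. if y \<in> U then b else a) S)"
      have z_cont: "z \<in> cont_maps T Y"
        using aY continuous_map_eq[of T Y "\<lambda>_. a" z] by (simp add: cont_maps_def z_def topT)
      have ind_cont: "ind U \<in> cont_maps T Y" if U: "U \<in> \<U>" for U
      proof -
        have "continuous_map T Y (ind U)"
          unfolding continuous_map_def
        proof (intro conjI allI impI)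
          show "ind U \<in> topspace T \<rightarrow> topspace Y"
            using aY b by (auto simp: ind_def topT)
          fix G assume "openin Y G"
          have "{y \<in> topspace T. ind U y \<in> G} =
              (if b \<in> G then U else {}) \<union> (if a \<in> G then S - U else {})" (is "_ = ?L \<union> ?R")
            using U by (auto simp: ind_def topT S_def)
          moreover have "openin T (?L \<union> ?R)"
            by (intro openin_Un) (use openU[OF U] open_compl[OF U] in auto)
          ultimately show "openin T {y \<in> topspace T. ind U y \<in> G}"
            by simp
        qed
        then show ?thesis
          by (simp add: cont_maps_def ind_def topT)
      qed
      \<comment> \<open>\<open>U\<close> is recovered as the set where its function takes the value
        \<open>b\<close>, since \<open>V\<close> separates \<open>a\<close> from \<open>b\<close>.
        This later turns finitely many functions into finitely many members.\<close>
      have ind_inj: "inj_on ind \<U>"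
      proof (rule inj_on_inverseI)
        fix U assume "U \<in> \<U>"
        then show "{y \<in> S. ind U y = b} = U"
          using V b by (auto simp: ind_def S_def)
      qed
      have fin: "finite {f \<in> ind ` \<U>. \<exists>x\<in>C. f x \<noteq> z x}" if C: "compactin T C" for C
      proof (rule finite_subset)
        show "{f \<in> ind ` \<U>. \<exists>x\<in>C. f x \<noteq> z x} \<subseteq> ind ` {U \<in> \<U>. U \<inter> C \<noteq> {}}"
        proof
          fix f assume "f \<in> {f \<in> ind ` \<U>. \<exists>x\<in>C. f x \<noteq> z x}"
          then obtain U y where U: "f = ind U" "U \<in> \<U>" and y: "y \<in> C" "ind U y \<noteq> z y"
            by blast
          then have "y \<in> U"
            by (auto simp: ind_def z_def restrict_def split: if_splits)
          then show "f \<in> ind ` {U \<in> \<U>. U \<inter> C \<noteq> {}}"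
            using U y by blast
        qed
        show "finite (ind ` {U \<in> \<U>. U \<inter> C \<noteq> {}})"
          using compact_finite[OF C] by blast
      qed
      define K where "K = insert z (ind ` \<U>)"
      let ?C = "compact_open_topology T Y"
      let ?P = "prod_topology (subtopology ?C K) T"
      have K: "K \<subseteq> cont_maps T Y"
        using z_cont ind_cont by (auto simp: K_def)
      have "compactin ?C K"
        unfolding K_def using z_cont ind_cont fin
        by (intro compactin_compact_open_insert_limit) auto
      then have ecK: "evenly_continuous T Y K"
        using ec S by (simp add: T_def)
      define R where "R = {p \<in> topspace ?P. (case p of (f, x) \<Rightarrow> f x) \<in> V}"
      have "openin ?P R"
        using ecK V(1) unfolding evenly_continuous_def R_def
        by (rule openin_continuous_map_preimage)
      moreover have "(z, x) \<in> R"
        using K V(2) by (auto simp: R_def topspace_compact_open_topology topT K_def z_def S_def)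
      ultimately obtain W' N where W': "openin (subtopology ?C K) W'" and N: "openin T N"
          and zx: "z \<in> W'" "x \<in> N" and sub: "W' \<times> N \<subseteq> R"
        unfolding openin_prod_topology_alt by metis
      obtain W where W: "openin ?C W" "W' = W \<inter> K"
        using W' by (auto simp: openin_subtopology)
      \<comment> \<open>A member meeting \<open>N\<close> has a point of \<open>N\<close> at which
        its function takes the value \<open>b\<close>, outside \<open>V\<close>; so that function
        lies outside \<open>W\<close>, as only finitely many do.\<close>
      define \<V> where "\<V> = {U \<in> \<U>. U \<inter> N \<noteq> {}}"
      have "finite {f \<in> ind ` \<U>. f \<notin> W}"
        using W zx(1) ind_cont fin by (intro finite_outside_compact_open_neighbourhood[where z = z]) auto
      moreover have "ind ` \<V> \<subseteq> {f \<in> ind ` \<U>. f \<notin> W}"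
      proof
        fix f assume "f \<in> ind ` \<V>"
        then obtain U where f: "f = ind U" and U: "U \<in> \<V>"
          by blast
        then obtain y where y: "y \<in> U" "y \<in> N" "U \<in> \<U>"
          by (auto simp: \<V>_def)
        have "ind U \<notin> W"
        proof
          assume "ind U \<in> W"
          then have "(ind U, y) \<in> W' \<times> N"
            using y W(2) by (simp add: K_def)
          then have "ind U y \<in> V"
            using sub by (auto simp: R_def)
          then show False
            using y b(2) by (auto simp: ind_def S_def split: if_splits)
        qed
        then show "f \<in> {f \<in> ind ` \<U>. f \<notin> W}"
          using f y(3) by blast
      qed
      ultimately have "finite (ind ` \<V>)"
        using finite_subset by blast
      then have "finite \<V>"
        by (rule finite_imageD) (use ind_inj in \<open>auto simp: \<V>_def intro: inj_on_subset\<close>)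
      \<comment> \<open>A finite union of sets whose closures miss \<open>x\<close> has closure
        missing \<open>x\<close>.\<close>
      then have "x \<notin> X closure_of \<Union>\<V>"
        using \<U>(3) by (simp add: closure_of_Union \<V>_def)
      then obtain M where M: "openin X M" "x \<in> M" "M \<inter> \<Union>\<V> = {}"
        using x unfolding in_closure_of by blast
      obtain N' where N': "openin X N'" "N = N' \<inter> S"
        using N by (auto simp: T_def openin_subtopology)
      have "x \<in> M \<inter> N'" "openin X (M \<inter> N')"
        using M N' zx(2) by auto
      \<comment> \<open>The member containing \<open>y\<close> meets \<open>N\<close> and hence
        belongs to \<open>\<V>\<close>, whose union \<open>M\<close> avoids.\<close>
      then obtain y where "y \<in> \<Union>\<U>" "y \<in> M" "y \<in> N'"
        using xU unfolding in_closure_of by blast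
      then show False
        using M(3) N'(2) by (auto simp: \<V>_def S_def)
    qed
  qed
qed

section \<open>The two equivalences\<close>

theorem theorem2p21:
  fixes X :: "'a topology"
  assumes "Tychonoff_space X"
  shows "(hereditary_two_Ascoli X \<longleftrightarrow> Frechet_Urysohn X) \<and>
         (hereditary_Ascoli X \<longleftrightarrow> Frechet_Urysohn X)"
proof -
  have X: "Hausdorff_space X"
    using assms by (simp add: Tychonoff_space_def)
  have "hereditary_two_Ascoli X" if "Frechet_Urysohn X"
    unfolding hereditary_two_Ascoli_def two_Ascoli_space_def
    by (intro allI impI Frechet_Urysohn_evenly_continuous Frechet_Urysohn_subtopology that
        regular_space_discrete_topology)
  moreover have "hereditary_Ascoli X" if "Frechet_Urysohn X"
    unfolding hereditary_Ascoli_def Ascoli_space_def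
    by (intro allI impI Frechet_Urysohn_evenly_continuous Frechet_Urysohn_subtopology that
        regular_space_euclidean)
  moreover have "Frechet_Urysohn X" if "hereditary_two_Ascoli X"
  proof (rule hereditary_evenly_continuous_imp_Frechet_Urysohn[OF X])
    show "evenly_continuous (subtopology X S) (discrete_topology {0, 1 :: nat}) K"
      if "S \<subseteq> topspace X"
        and "compactin (compact_open_topology (subtopology X S) (discrete_topology {0, 1 :: nat})) K"
      for S K
      using \<open>hereditary_two_Ascoli X\<close> that
      unfolding hereditary_two_Ascoli_def two_Ascoli_space_def by blast
    show "openin (discrete_topology {0, 1 :: nat}) {0}"
      by simp
    show "0 \<in> {0 :: nat}" "1 \<in> topspace (discrete_topology {0, 1 :: nat})" "1 \<notin> {0 :: nat}"
      by simp_all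
  qed
  moreover have "Frechet_Urysohn X" if "hereditary_Ascoli X"
  proof (rule hereditary_evenly_continuous_imp_Frechet_Urysohn[OF X])
    show "evenly_continuous (subtopology X S) (euclidean :: real topology) K"
      if "S \<subseteq> topspace X"
        and "compactin (compact_open_topology (subtopology X S) (euclidean :: real topology)) K"
      for S K
      using \<open>hereditary_Ascoli X\<close> that
      unfolding hereditary_Ascoli_def Ascoli_space_def by blast
    show "openin euclidean {..<1 :: real}"
      by simp
    show "0 \<in> {..<1 :: real}" "1 \<in> topspace (euclidean :: real topology)" "1 \<notin> {..<1 :: real}"
      by simp_all
  qed
  ultimately show ?thesis
    by blast
qed

end
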